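(* Fix $\beta\in[0,2)$ and $h=(2-\beta)\pi^2$. For a positive integer $N_t$ put $T=\sqrt{N_t h/4}$ and define, for $z\in\mathbb{C}$, $$r_t(z) = \frac{zh}{\pi} \sum_{j=1}^{N_t} \frac{1}{\sqrt{jh}} \cdot \frac{e^{\sqrt{jh}-\sqrt{N_t h/4}}}{e^{2\sqrt{jh}-2\sqrt{N_t h/4}} + z}.$$ Assume there is a constant $K$ such that for all sufficiently large $N_t$ and all $z = r e^{\pm i\beta\pi/2}$ with $r\in[e^{4+2\beta-2T},1]$, $$\left|\int_\Gamma f(u,z)\,\delta(u)\,du\right| \le K e^{-T},$$ where $f,\delta,\Gamma$ are as in the context. Then $$|r_t(z)-\sqrt{z}\,| = \mathcal{O}\big(e^{-\sqrt{N_t h/4}}\big) = \mathcal{O}\big(e^{-\pi\sqrt{(2-\beta)N_t/4}}\big)$$ as $N_t\to\infty$, uniformly for $z\in\{re^{i\beta\pi/2}: r\in[0,1]\}\cup\{re^{-i\beta\pi/2}: r\in[0,1]\}$.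
   Context: Here $\sqrt{\cdot}$ denotes the principal branch of the square root. For $u,z\in\mathbb{C}$, $f(u,z) = \frac{z}{\pi}\,\frac{1}{\sqrt{u}}\,\frac{e^{\sqrt{u}-T}}{e^{2(\sqrt{u}-T)}+z}$. The function $\delta(u)=\mu(u)-m(u)$, where $\mu(u)=-\tfrac12$ if $\operatorname{Im}u\ge 0$ and $\mu(u)=\tfrac12$ if $\operatorname{Im}u<0$, and $m(u) = -\tfrac{i}{2}\cot(\pi u/h)$. For $z=re^{\pm i\beta\pi/2}$, the contour $\Gamma$ is the positively oriented boundary of the rectangle $\{u: 1-\beta/2\le \operatorname{Re}u\le 4T^2+1-\beta/2,\ |\operatorname{Im}u|\le a\}$ with $a = 2\pi(T+\tfrac12\log r)$. *)

theory Defs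
  imports "HOL-Complex_Analysis.Complex_Analysis"
begin

definition hpar :: "real \<Rightarrow> real" where
  "hpar \<beta> = (2 - \<beta>) * pi\<^sup>2"

definition Tpar :: "real \<Rightarrow> nat \<Rightarrow> real" where
  "Tpar \<beta> N = sqrt (real N * hpar \<beta> / 4)"

definition r_t :: "real \<Rightarrow> nat \<Rightarrow> complex \<Rightarrow> complex" where
  "r_t \<beta> N z = z * complex_of_real (hpar \<beta> / pi) *
     (\<Sum>j=1..N. complex_of_real (1 / sqrt (real j * hpar \<beta>)) *
        (complex_of_real (exp (sqrt (real j * hpar \<beta>) - sqrt (real N * hpar \<beta> / 4))) /
         (complex_of_real (exp (2 * sqrt (real j * hpar \<beta>) - 2 * sqrt (real N * hpar \<beta> / 4))) + z)))"

definition fint :: "real \<Rightarrow> nat \<Rightarrow> complex \<Rightarrow> complex \<Rightarrow> complex" where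
  "fint \<beta> N u z = z / complex_of_real pi * (1 / csqrt u) *
     (exp (csqrt u - complex_of_real (Tpar \<beta> N)) /
      (exp (2 * (csqrt u - complex_of_real (Tpar \<beta> N))) + z))"

definition mu :: "complex \<Rightarrow> complex" where
  "mu u = (if Im u \<ge> 0 then - 1/2 else 1/2)"

definition mfun :: "real \<Rightarrow> complex \<Rightarrow> complex" where
  "mfun \<beta> u = - (\<i> / 2) * cot (complex_of_real pi * u / complex_of_real (hpar \<beta>))"

definition delta :: "real \<Rightarrow> complex \<Rightarrow> complex" where
  "delta \<beta> u = mu u - mfun \<beta> u"

definition apar :: "real \<Rightarrow> nat \<Rightarrow> real \<Rightarrow> real" where
  "apar \<beta> N r = 2 * pi * (Tpar \<beta> N + ln r / 2)"

definition Gamma :: "real \<Rightarrow> nat \<Rightarrow> real \<Rightarrow> real \<Rightarrow> complex" where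
  "Gamma \<beta> N r = rectpath (Complex (1 - \<beta>/2) (- apar \<beta> N r))
                         (Complex (4 * (Tpar \<beta> N)\<^sup>2 + 1 - \<beta>/2) (apar \<beta> N r))"

end

theory Submission
  imports Defs
begin

text \<open>
  Put \<open>\<theta> = \<plusminus>\<beta>\<pi>/4\<close>, so that \<open>z = r exp (2i\<theta>)\<close>, and \<open>L = T + (ln r)/2\<close>. Inside \<open>\<Gamma>\<close> the integrand
  \<open>f\<close> has exactly the two simple poles \<open>p = (L + i(\<theta> \<plusminus> \<pi>/2))\<^sup>2\<close>, with residues of modulus
  \<open>exp (L - T)/\<pi>\<close>. Integrating \<open>f m\<close> around \<open>\<Gamma>\<close> produces \<open>r\<^sub>t(z)\<close> from the poles of the cotangent, while
  integrating \<open>f \<mu>\<close> produces the integral of \<open>f\<close> along the real segment inside \<open>\<Gamma>\<close>; both also pick up the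
  poles of \<open>f\<close>. Hence \<open>r\<^sub>t(z)\<close> is that real integral, minus the integral of \<open>f \<delta>\<close>, plus
  \<open>2\<pi>i \<Sum> Res(f,p) \<delta>(p)\<close>. Since \<open>|\<delta>(p)| \<le> 2 exp (-L)\<close>, the last sum is of order \<open>exp (-T)\<close>. The real integral
  has the primitive \<open>(2\<surd>z/\<pi>) Arctan (exp (\<surd>u - T)/\<surd>z)\<close> and differs from \<open>\<surd>z\<close> by two
  arctangents of order \<open>exp (-T)\<close>. For \<open>r\<close> below the range of the hypothesis, \<open>r\<^sub>t(z)\<close> and \<open>\<surd>z\<close> are
  both of order \<open>exp (-T)\<close>.
\<close>

section \<open>Contour integrals over rectangles\<close>

text \<open>No point of \<open>pts\<close> lies on the boundary, so each one is either in the open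
  box, with winding number 1, or off the closed box, with winding number 0. Degenerate rectangles
  are covered too: their open box is empty.\<close>

lemma contour_integral_rectpath_residues:
  assumes S: "open S" "connected S" "cbox a b \<subseteq> S" and "finite pts"
    and holo: "f holomorphic_on S - pts"
    and le: "Re a \<le> Re b" "Im a \<le> Im b"
    and pts: "path_image (rectpath a b) \<inter> pts = {}"
  shows "contour_integral (rectpath a b) f = 2 * pi * \<i> * (\<Sum>p\<in>pts \<inter> box a b. residue f p)"
proof -
  have sub: "path_image (rectpath a b) \<subseteq> cbox a b"
    using le by (rule path_image_rectpath_subset_cbox)
  have out: "winding_number (rectpath a b) w = 0" if "w \<notin> cbox a b" for w
    using winding_number_rectpath_outside[OF le that] .
  have "contour_integral (rectpath a b) f
      = 2 * pi * \<i> * (\<Sum>p\<in>pts. winding_number (rectpath a b) p * residue f p)"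
    using assms sub out by (intro Residue_theorem[of S]) auto
  also have "(\<Sum>p\<in>pts. winding_number (rectpath a b) p * residue f p)
      = (\<Sum>p\<in>pts. if p \<in> box a b then residue f p else 0)"
  proof (rule sum.cong)
    fix p assume "p \<in> pts"
    then have "p \<in> box a b \<or> p \<notin> cbox a b"
      using pts path_image_rectpath_cbox_minus_box[OF le] by auto
    then show "winding_number (rectpath a b) p * residue f p
        = (if p \<in> box a b then residue f p else 0)"
      using winding_number_rectpath[of p a b] out[of p] box_subset_cbox[of a b] by auto
  qed simp
  finally show ?thesis
    using \<open>finite pts\<close> by (simp add: sum.inter_restrict)
qed

text \<open>Analyticity at the single point \<open>p\<close> spares naming a common domain; the
  smaller of the two balls around \<open>p\<close> serves as one.\<close>

lemma residue_simple_pole_deriv_analytic: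
  assumes "f analytic_on {p}" "g analytic_on {p}"
    and "(g has_field_derivative g') (at p)" "f p \<noteq> 0" "g p = 0" "g' \<noteq> 0"
  shows "residue (\<lambda>w. f w / g w) p = f p / g'"
proof -
  obtain d e where de: "d > 0" "f holomorphic_on ball p d" "e > 0" "g holomorphic_on ball p e"
    using assms(1,2) by (auto simp: analytic_on_def)
  show ?thesis
    by (rule residue_simple_pole_deriv[of _ "ball p (min d e)"])
       (use de assms in \<open>auto intro: holomorphic_on_subset\<close>)
qed

text \<open>Needed for \<open>mu\<close>, which takes its upper value on the real axis: along a
  segment that rises to the axis from below, \<open>mu\<close> differs from the constant 1/2 at the
  end point only, a null set.\<close>

lemma has_contour_integral_linepath_spike_finish:
  assumes "(f has_contour_integral i) (linepath a b)"
    and eq: "\<And>x. x \<in> closed_segment a b \<Longrightarrow> x \<noteq> b \<Longrightarrow> g x = f x"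
  shows "(g has_contour_integral i) (linepath a b)"
proof (cases "a = b")
  case False
  have *: "g (linepath a b x) = f (linepath a b x)" if "x \<in> {0..1} - {1}" for x
  proof (rule eq)
    show "linepath a b x \<in> closed_segment a b"
      using that by (intro linepath_in_path) simp
    have "linepath a b x - b = (1 - x) *\<^sub>R (a - b)"
      by (simp add: linepath_def algebra_simps)
    moreover have "(1 - x) *\<^sub>R (a - b) \<noteq> 0" using False that by simp
    ultimately show "linepath a b x \<noteq> b" by auto
  qed
  show ?thesis
    unfolding has_contour_integral_linepath
  proof (rule has_integral_spike_finite)
    show "((\<lambda>x. f (linepath a b x) * (b - a)) has_integral i) {0..1}"
      using assms(1) by (simp only: has_contour_integral_linepath)
    show "g (linepath a b x) * (b - a) = f (linepath a b x) * (b - a)" if "x \<in> {0..1} - {1}" for x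
      using *[OF that] by (simp only:)
  qed simp
next
  case True
  then show ?thesis using assms(1) by simp
qed

text \<open>The function \<open>mu\<close> jumps where the rectangle crosses the real axis, so the vertical sides are cut there.\<close>

lemma has_contour_integral_rectpath_mu:
  fixes x0 x1 A :: real
  assumes "x0 \<le> x1" "0 < A"
    and cont: "continuous_on ({u. Re u \<in> {x0..x1} \<and> Im u \<in> {-A, 0, A}} \<union> {u. Re u \<in> {x0, x1} \<and> Im u \<in> {-A..A}}) f"
  shows "((\<lambda>u. f u * mu u) has_contour_integral
           (contour_integral (linepath (Complex x0 0) (Complex x1 0)) f
            + contour_integral (rectpath (Complex x0 (-A)) (Complex x1 0)) f / 2
            - contour_integral (rectpath (Complex x0 0) (Complex x1 A)) f / 2))
         (rectpath (Complex x0 (-A)) (Complex x1 A))"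
proof -
  define a1 a2 a3 a4 c0 c1
    where "a1 = Complex x0 (-A)" and "a2 = Complex x1 (-A)" and "a3 = Complex x1 A"
      and "a4 = Complex x0 A" and "c0 = Complex x0 0" and "c1 = Complex x1 0"
  note pts = a1_def a2_def a3_def a4_def c0_def c1_def
  define K where "K = {u. Re u \<in> {x0..x1} \<and> Im u \<in> {-A, 0, A}} \<union> {u. Re u \<in> {x0, x1} \<and> Im u \<in> {-A..A}}"
  define J where "J p q = contour_integral (linepath p q) f" for p q
  have seg: "closed_segment a1 a2 \<subseteq> K" "closed_segment a2 c1 \<subseteq> K" "closed_segment c1 a3 \<subseteq> K"
    "closed_segment a3 a4 \<subseteq> K" "closed_segment a4 c0 \<subseteq> K" "closed_segment c0 a1 \<subseteq> K"
    "closed_segment c0 c1 \<subseteq> K"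
    using assms(1,2)
    by (simp_all add: pts K_def closed_segment_same_Re closed_segment_same_Im closed_segment_eq_real_ivl subset_iff)
  have J: "(f has_contour_integral J p q) (linepath p q)" if "closed_segment p q \<subseteq> K" for p q
    using contour_integrable_continuous_linepath[of p q f] continuous_on_subset[OF cont, of "closed_segment p q"]
      that unfolding J_def K_def by (simp add: has_contour_integral_integral)
  have Jrev: "J q p = - J p q" if "closed_segment p q \<subseteq> K" for p q
    using has_contour_integral_reverse_linepath[OF J[OF that]]
    by (simp add: J_def contour_integral_unique)
  have low: "contour_integral (rectpath a1 c1) f = J a1 a2 + (J a2 c1 + (- J c0 c1 + J c0 a1))"
  proof -
    have "(f has_contour_integral J c1 c0) (linepath c1 c0)"
      using seg(7) by (intro J) (simp add: closed_segment_commute)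
    note has_contour_integral_join[OF J[OF seg(1)] has_contour_integral_join[OF J[OF seg(2)]
        has_contour_integral_join[OF this J[OF seg(6)]]]]
    then show ?thesis
      using Jrev[OF seg(7)] by (simp add: rectpath_def Let_def contour_integral_unique pts)
  qed
  have up: "contour_integral (rectpath c0 a3) f = J c0 c1 + (J c1 a3 + (J a3 a4 + J a4 c0))"
  proof -
    note has_contour_integral_join[OF J[OF seg(7)] has_contour_integral_join[OF J[OF seg(3)]
        has_contour_integral_join[OF J[OF seg(4)] J[OF seg(5)]]]]
    then show ?thesis
      by (simp add: rectpath_def Let_def contour_integral_unique pts)
  qed
  let ?g = "\<lambda>u. f u * mu u"
  \<comment> \<open>With \<open>Im p\<close> strictly negative the segment can touch the real axis
    only at \<open>q\<close>, which is the one point that the spike lemma ignores.\<close>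
  have below: "(?g has_contour_integral J p q * (1/2)) (linepath p q)"
    if "closed_segment p q \<subseteq> K" "Im p < 0" "Im q \<le> 0" for p q
  proof (rule has_contour_integral_linepath_spike_finish)
    show "((\<lambda>u. f u * (1/2)) has_contour_integral J p q * (1/2)) (linepath p q)"
      by (intro has_contour_integral_rmul J that)
    fix x assume x: "x \<in> closed_segment p q" "x \<noteq> q"
    then obtain t where t: "0 \<le> t" "t \<le> 1" "x = (1 - t) *\<^sub>R p + t *\<^sub>R q"
      unfolding in_segment by blast
    with x(2) have "t \<noteq> 1" by auto
    with t(2) have "t < 1" by simp
    from t(3) have "Im x = (1 - t) * Im p + t * Im q" by simp
    moreover have "(1 - t) * Im p < 0" "t * Im q \<le> 0"
      using t \<open>t < 1\<close> that by (simp_all add: mult_pos_neg mult_nonneg_nonpos)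
    ultimately show "f x * mu x = f x * (1/2)" by (simp add: mu_def)
  qed
  have above: "(?g has_contour_integral J p q * (-1/2)) (linepath p q)"
    if "closed_segment p q \<subseteq> K" "Im p \<ge> 0" "Im q \<ge> 0" for p q
  proof (rule has_contour_integral_eq)
    show "((\<lambda>u. f u * (-1/2)) has_contour_integral J p q * (-1/2)) (linepath p q)"
      by (intro has_contour_integral_rmul J that)
    fix x assume "x \<in> path_image (linepath p q)"
    then obtain t where t: "0 \<le> t" "t \<le> 1" "x = (1 - t) *\<^sub>R p + t *\<^sub>R q"
      unfolding path_image_linepath in_segment by blast
    then have "Im x = (1 - t) * Im p + t * Im q" by simp
    also have "\<dots> \<ge> 0" using t(1,2) that by (intro add_nonneg_nonneg mult_nonneg_nonneg) auto
    finally show "f x * (- 1/2) = f x * mu x" by (simp add: mu_def)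
  qed
  note A = \<open>0 < A\<close>
  \<comment> \<open>The crossing point \<open>c1\<close> is the midpoint of the side, hence the
    parameter 1/2.\<close>
  have right: "(?g has_contour_integral (J a2 c1 * (1/2) + J c1 a3 * (-1/2))) (linepath a2 a3)"
  proof (rule has_contour_integral_split[where k="1/2" and c=c1])
    show "(?g has_contour_integral J a2 c1 * (1/2)) (linepath a2 c1)"
      by (rule below[OF seg(2)]) (use A in \<open>simp_all add: pts\<close>)
    show "(?g has_contour_integral J c1 a3 * (-1/2)) (linepath c1 a3)"
      by (rule above[OF seg(3)]) (use A in \<open>simp_all add: pts\<close>)
  qed (simp_all add: pts complex_eq_iff)
  \<comment> \<open>This piece starts on the real axis instead of ending there, so the reversed
    segment is treated first.\<close>
  have "(?g has_contour_integral - (J a1 c0 * (1/2))) (linepath c0 a1)"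
    by (rule has_contour_integral_reverse_linepath, rule below)
       (use seg(6) A in \<open>auto simp: pts closed_segment_commute\<close>)
  moreover have "J a1 c0 = - J c0 a1" using seg(6) by (rule Jrev)
  ultimately have "(?g has_contour_integral J c0 a1 * (1/2)) (linepath c0 a1)" by simp
  moreover have "(?g has_contour_integral J a4 c0 * (-1/2)) (linepath a4 c0)"
    by (rule above[OF seg(5)]) (use A in \<open>simp_all add: pts\<close>)
  ultimately have left: "(?g has_contour_integral (J a4 c0 * (-1/2) + J c0 a1 * (1/2))) (linepath a4 a1)"
    by (intro has_contour_integral_split[where k="1/2" and c=c0]) (simp_all add: pts complex_eq_iff)
  have bottom: "(?g has_contour_integral J a1 a2 * (1/2)) (linepath a1 a2)"
    by (rule below[OF seg(1)]) (use A in \<open>simp_all add: pts\<close>)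
  have top: "(?g has_contour_integral J a3 a4 * (-1/2)) (linepath a3 a4)"
    by (rule above[OF seg(4)]) (use A in \<open>simp_all add: pts\<close>)
  have "(?g has_contour_integral
         (J a1 a2 * (1/2) + ((J a2 c1 * (1/2) + J c1 a3 * (-1/2)) + (J a3 a4 * (-1/2) + (J a4 c0 * (-1/2) + J c0 a1 * (1/2))))))
      (linepath a1 a2 +++ linepath a2 a3 +++ linepath a3 a4 +++ linepath a4 a1)"
    by (rule has_contour_integral_join[OF bottom has_contour_integral_join[OF right has_contour_integral_join[OF top left]]])
       auto
  also have "(linepath a1 a2 +++ linepath a2 a3 +++ linepath a3 a4 +++ linepath a4 a1) = rectpath a1 a3"
    by (simp add: rectpath_def Let_def pts)
  \<comment> \<open>The two half rectangles run along the segment from \<open>c0\<close> to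
    \<open>c1\<close> in opposite directions. Half of the lower minus half of the upper integral
    therefore contains that segment with weight -1, which the extra term \<open>J c0 c1\<close>
    cancels.\<close>
  also have "(J a1 a2 * (1/2) + ((J a2 c1 * (1/2) + J c1 a3 * (-1/2)) + (J a3 a4 * (-1/2) + (J a4 c0 * (-1/2) + J c0 a1 * (1/2)))))
    = J c0 c1 + contour_integral (rectpath a1 c1) f / 2 - contour_integral (rectpath c0 a3) f / 2"
  proof -
    have "a * (1/2) + ((b * (1/2) + c * (-1/2)) + (d * (-1/2) + (e * (-1/2) + k * (1/2))))
        = x + (a + (b + (- x + k))) / 2 - (x + (c + (d + e))) / 2" for a b c d e k x :: complex
      by (simp add: add_divide_distrib diff_divide_distrib)
    then show ?thesis unfolding low up .
  qed
  finally show ?thesis unfolding J_def pts .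
qed

section \<open>Exponential decay of \<open>delta\<close> away from the real axis\<close>

text \<open>With \<open>E = exp (2 * \<i> * w)\<close> the expression equals E / (1 - E). Since x is
  at least 1, E has modulus at most exp (-1) and so at most 1/2, which bounds the denominator below
  by 1/2.\<close>

lemma norm_half_cot_minus_half_le:
  assumes "2 * Im w \<ge> x" "x \<ge> 1"
  shows "norm (- 1/2 + \<i>/2 * cot w) \<le> 2 * exp (- x)"
proof -
  define E where "E = exp (2 * \<i> * w)"
  have nE: "norm E \<le> exp (-x)" using assms by (simp add: E_def)
  have "exp (-x) \<le> exp (-1)" using assms by simp
  also have "exp (-1) \<le> (1/2 :: real)"
    using exp_ge_add_one_self[of 1] by (simp add: exp_minus field_simps)
  finally have half: "norm E \<le> 1/2" using nE by simp
  then have E1: "E \<noteq> 1" by auto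
  have ee: "exp (\<i> * w) * exp (\<i> * w) = E" "exp (\<i> * w) * exp (-(\<i> * w)) = 1"
    by (auto simp: E_def mult_exp_exp mult_ac)
  have "cot w = (exp (\<i> * w) * cos w) / (exp (\<i> * w) * sin w)"
    by (simp add: cot_def)
  also have "exp (\<i> * w) * cos w = (E + 1) / 2"
    using ee by (simp add: cos_exp_eq distrib_left)
  also have "exp (\<i> * w) * sin w = (E - 1) / (2 * \<i>)"
    unfolding sin_exp_eq times_divide_eq_right right_diff_distrib ee ..
  also have "(E + 1) / 2 / ((E - 1) / (2 * \<i>)) = \<i> * ((E + 1) / (E - 1))"
    using E1 by (simp add: field_simps)
  finally have cot: "cot w = \<i> * ((E + 1) / (E - 1))" .
  have "- 1/2 + \<i>/2 * cot w = E / (1 - E)"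
    unfolding cot using E1 by (simp add: divide_simps) (simp add: algebra_simps)
  moreover have "norm (1 - E) \<ge> 1/2"
    using half norm_triangle_ineq2[of 1 E] by simp
  ultimately have "norm (- 1/2 + \<i>/2 * cot w) \<le> norm E / (1/2)"
    by (simp only: norm_divide) (intro divide_left_mono, auto)
  then show ?thesis using nE by simp
qed

text \<open>In the upper half plane this is the preceding estimate at w = pi u / h. In the lower
  half plane \<open>mu\<close> changes sign and \<open>cot\<close> is odd, so the estimate applies
  to -w.\<close>

lemma norm_delta_le:
  assumes "2 * pi * \<bar>Im u\<bar> / hpar \<beta> \<ge> x" "x \<ge> 1" "hpar \<beta> > 0"
  shows "norm (delta \<beta> u) \<le> 2 * exp (- x)"
proof -
  define w where "w = complex_of_real pi * u / complex_of_real (hpar \<beta>)"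
  have Imw: "Im w = pi * Im u / hpar \<beta>" by (simp add: w_def)
  show ?thesis
  proof (cases "Im u \<ge> 0")
    case True
    then have "norm (- 1/2 + \<i>/2 * cot w) \<le> 2 * exp (- x)"
      using assms by (intro norm_half_cot_minus_half_le) (auto simp: Imw)
    then show ?thesis using True by (simp add: delta_def mu_def mfun_def w_def)
  next
    case False
    then have "norm (- 1/2 + \<i>/2 * cot (-w)) \<le> 2 * exp (- x)"
      using assms by (intro norm_half_cot_minus_half_le) (auto simp: Imw)
    also have "- 1/2 + \<i>/2 * cot (-w) = - delta \<beta> u"
      using False by (simp add: delta_def mu_def mfun_def w_def cot_def)
    finally show ?thesis by simp
  qed
qed

section \<open>Estimates on a ray, the arctangent, and a Riemann sum\<close>

text \<open>Rotation by the angle \<open>- \<theta>\<close> moves the two summands to the angles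
  \<open>- \<theta>\<close> and \<open>\<theta>\<close>, where both real parts carry the same factor
  \<open>cos \<theta>\<close>. This keeps denominators away from 0 uniformly in
  \<open>r\<close>.\<close>

lemma norm_of_real_add_cis_ge:
  assumes "x \<ge> 0" "r \<ge> 0"
  shows "norm (of_real x + of_real r * exp (\<i> * of_real (2 * \<theta>))) \<ge> (x + r) * cos \<theta>"
proof -
  have "(x + r) * cos \<theta> = Re (exp (- \<i> * \<theta>) * (of_real x + of_real r * exp (\<i> * of_real (2 * \<theta>))))"
  proof -
    have "exp (- \<i> * \<theta>) * (of_real x + of_real r * exp (\<i> * of_real (2 * \<theta>)))
      = of_real x * exp (- \<i> * \<theta>) + of_real r * exp (\<i> * \<theta>)"
      by (simp add: algebra_simps mult_exp_exp)
    then show ?thesis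
      by (simp only:) (simp add: Re_exp algebra_simps)
  qed
  also have "\<dots> \<le> norm (exp (- \<i> * \<theta>) * (of_real x + of_real r * exp (\<i> * of_real (2 * \<theta>))))"
    by (rule complex_Re_le_cmod)
  finally show ?thesis by (simp add: norm_mult)
qed

text \<open>Mean value estimate along the segment from 0: by the preceding lemma 1 + w^2 has modulus
  at least \<open>cos \<theta>\<close> there.\<close>

lemma norm_Arctan_le:
  assumes "\<rho> \<ge> 0" "cos \<theta> > 0"
  shows "norm (Arctan (of_real \<rho> * exp (\<i> * of_real \<theta>))) \<le> \<rho> / cos \<theta>"
proof -
  define e where "e = exp (\<i> * of_real \<theta>)"
  have "norm (Arctan (of_real \<rho> * e) - Arctan 0) \<le> inverse (cos \<theta>) * norm (of_real \<rho> * e - 0)"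
  proof (rule field_differentiable_bound[where S="closed_segment 0 (of_real \<rho> * e)" and f'="\<lambda>w. inverse (1 + w\<^sup>2)"])
    fix w assume "w \<in> closed_segment 0 (of_real \<rho> * e)"
    then obtain t where t: "0 \<le> t" "w = of_real (t * \<rho>) * e"
      by (auto simp: in_segment scaleR_conv_of_real)
    have Rew: "Re w = t * \<rho> * cos \<theta>" "Im w = t * \<rho> * sin \<theta>"
      using t by (auto simp: e_def Re_exp Im_exp)
    show "(Arctan has_field_derivative inverse (1 + w\<^sup>2)) (at w within closed_segment 0 (of_real \<rho> * e))"
      by (rule has_field_derivative_at_within, rule has_field_derivative_Arctan) (use Rew assms in auto)
    have "w\<^sup>2 = of_real ((t * \<rho>)\<^sup>2) * exp (\<i> * of_real (2 * \<theta>))"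
      using t by (simp add: e_def power_mult_distrib power2_eq_square mult_exp_exp algebra_simps)
    then have "norm (1 + w\<^sup>2) \<ge> (1 + (t * \<rho>)\<^sup>2) * cos \<theta>"
      using norm_of_real_add_cis_ge[of 1 "(t * \<rho>)\<^sup>2" \<theta>] by simp
    moreover have "(1 + (t * \<rho>)\<^sup>2) * cos \<theta> \<ge> 1 * cos \<theta>"
      using assms by (intro mult_right_mono) auto
    ultimately have "cos \<theta> \<le> norm (1 + w\<^sup>2)" by linarith
    then show "norm (inverse (1 + w\<^sup>2)) \<le> inverse (cos \<theta>)"
      using assms by (simp add: norm_inverse le_imp_inverse_le)
  qed auto
  then show ?thesis
    using assms by (simp add: e_def norm_mult field_simps)
qed

text \<open>The derivative of the left side vanishes on the right half plane, which is convex, and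
  the constant is read off at 1.\<close>

lemma Arctan_add_Arctan_inverse:
  assumes "Re w > 0"
  shows "Arctan w + Arctan (inverse w) = of_real (pi / 2)"
proof -
  let ?S = "{w. Re w > 0}"
  have cv: "convex ?S" by (rule convex_halfspace_Re_gt)
  have "\<exists>c. \<forall>w\<in>?S. Arctan w + Arctan (inverse w) = c"
  proof (rule has_field_derivative_zero_constant[OF cv])
    fix w assume "w \<in> ?S"
    then have w: "Re w > 0" "w \<noteq> 0" by auto
    then have Ri: "Re (inverse w) > 0" by (auto simp: Re_divide inverse_eq_divide add_pos_nonneg)
    have nz: "1 + w\<^sup>2 \<noteq> 0"
    proof
      assume "1 + w\<^sup>2 = 0"
      then have "(w - \<i>) * (w + \<i>) = 0" by (simp add: algebra_simps power2_eq_square)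
      then have "w = \<i> \<or> w = - \<i>" by (simp add: eq_neg_iff_add_eq_0)
      then show False using w by auto
    qed
    have "((\<lambda>w. Arctan w + Arctan (inverse w)) has_field_derivative
        inverse (1 + w\<^sup>2) + inverse (1 + (inverse w)\<^sup>2) * - (inverse w ^ 2)) (at w)"
      using w Ri
      by (intro DERIV_add has_field_derivative_Arctan DERIV_chain2[OF has_field_derivative_Arctan])
         (auto intro!: derivative_eq_intros simp: power2_eq_square)
    moreover have "inverse (1 + w\<^sup>2) + inverse (1 + (inverse w)\<^sup>2) * - (inverse w ^ 2) = 0"
      using w nz by (simp add: field_simps)
    ultimately show "((\<lambda>w. Arctan w + Arctan (inverse w)) has_field_derivative 0) (at w within ?S)"
      by (simp add: has_field_derivative_at_within)
  qed
  then obtain c where c: "\<And>w. Re w > 0 \<Longrightarrow> Arctan w + Arctan (inverse w) = c" by auto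
  have "c = of_real (pi / 2)"
  proof -
    have "Arctan 1 = of_real (pi / 4)"
      using Arctan_of_real[of 1] by (simp only: arctan_one of_real_1)
    moreover have "c = 2 * Arctan 1" using c[of 1] by simp
    ultimately show ?thesis by (simp only:) simp
  qed
  then show ?thesis using c assms by simp
qed

text \<open>This is a lower Riemann sum for the integral of exp (- sqrt x) / sqrt x over the
  positive reals, whose value is 2.\<close>

lemma sum_exp_minus_sqrt_le:
  assumes "h > 0"
  shows "(\<Sum>j=1..N. h / sqrt (real j * h) * exp (- sqrt (real j * h))) \<le> 2"
proof -
  \<comment> \<open>Subtracting the tail of the integral beyond N h makes the bound inductive: each
    new term is at most 2 exp (-a) - 2 exp (-b) for consecutive square roots a, b.\<close>
  have "(\<Sum>j=1..N. h / sqrt (real j * h) * exp (- sqrt (real j * h))) \<le> 2 - 2 * exp (- sqrt (real N * h))"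
  proof (induction N)
    case (Suc N)
    define a b where "a = sqrt (real N * h)" and "b = sqrt (real (Suc N) * h)"
    have ab: "0 \<le> a" "a \<le> b" "0 < b" and hb: "h = b\<^sup>2 - a\<^sup>2"
      using assms by (auto simp: a_def b_def algebra_simps intro!: add_pos_nonneg)
    have "h / b = (b - a) * ((b + a) / b)" unfolding hb by (simp add: power2_eq_square algebra_simps)
    also have "\<dots> \<le> (b - a) * 2"
      using ab by (intro mult_left_mono) (auto simp: field_simps)
    also have "\<dots> \<le> (exp (b - a) - 1) * 2"
      by (intro mult_right_mono) (metis add.commute exp_ge_add_one_self le_diff_eq, simp)
    finally have "h / b * exp (- b) \<le> (exp (b - a) - 1) * 2 * exp (- b)"
      by (intro mult_right_mono) auto
    also have "\<dots> = 2 * exp (- a) - 2 * exp (- b)"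
      by (simp add: algebra_simps flip: exp_add)
    finally show ?case using Suc by (simp add: a_def b_def)
  qed simp
  then show ?thesis using exp_ge_zero[of "- sqrt (real N * h)"] by linarith
qed

section \<open>The integrand on one ray: its domain and its poles\<close>

text \<open>Fixing only the absolute value of \<open>\<theta>\<close> treats both rays at once. The
  assumption \<open>log_r\<close> is the lower bound exp (4 + 2 beta - 2 T) on \<open>r\<close>, in
  logarithmic form.\<close>

locale ray_quadrature =
  fixes \<beta> r \<theta> :: real and N :: nat
  assumes beta: "0 \<le> \<beta>" "\<beta> < 2"
    and theta: "\<bar>\<theta>\<bar> = \<beta> * pi / 4"
    and r: "0 < r" "r \<le> 1"
    and log_r: "2 + \<beta> \<le> Tpar \<beta> N + ln r / 2"
begin

abbreviation h :: real where "h \<equiv> hpar \<beta>"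
abbreviation T :: real where "T \<equiv> Tpar \<beta> N"

definition z :: complex where "z = of_real r * exp (\<i> * of_real (2 * \<theta>))"
text \<open>Chosen so that exp (L - T) = sqrt r; it is the real part of \<open>csqrt u\<close> at
  every zero of \<open>den\<close>.\<close>

definition L :: real where "L = T + ln r / 2"
definition c :: real where "c = 1 - \<beta> / 2"
definition pole :: "real \<Rightarrow> complex" where "pole y = (Complex L (\<theta> + y))\<^sup>2"

definition den :: "complex \<Rightarrow> complex" where "den u = exp (2 * (csqrt u - of_real T)) + z"
definition num :: "complex \<Rightarrow> complex"
  where "num u = z / of_real pi * (1 / csqrt u) * exp (csqrt u - of_real T)"

text \<open>The bound on the imaginary part excludes all zeros of the denominator but two.\<close>

definition region :: "complex set"
  where "region = {u. 0 < Re u \<and> Re u < real (Suc N) * h \<and> \<bar>Im u\<bar> < 2 * L * (3 * pi / 2 - \<bar>\<theta>\<bar>)}"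

lemma fint_eq: "fint \<beta> N u z = num u / den u"
  by (simp add: fint_def num_def den_def)

lemma theta_less: "\<bar>\<theta>\<bar> < pi / 2" "- pi / 2 < \<theta>" "\<theta> < pi / 2"
proof -
  have "\<beta> * pi < 2 * pi" using beta by (intro mult_strict_right_mono) auto
  then show "\<bar>\<theta>\<bar> < pi / 2" unfolding theta by (simp only: divide_simps) simp
  then show "- pi / 2 < \<theta>" "\<theta> < pi / 2" by auto
qed

lemma cos_theta: "cos \<theta> > 0"
  using theta_less by (intro cos_gt_zero_pi) auto

lemma h_pos: "h > 0" using beta by (simp add: hpar_def)

lemma h_c: "h = 2 * c * pi\<^sup>2" by (simp add: hpar_def c_def field_simps)

text \<open>These put the left edge of the contour between the branch point 0 and the first node h,
  and the right edge N h + c between the nodes N h and (N + 1) h.\<close>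

lemma c_bounds: "0 < c" "c \<le> 1" "c < h"
proof -
  show c: "0 < c" "c \<le> 1" using beta by (auto simp: c_def)
  have "pi\<^sup>2 > 2\<^sup>2" using pi_gt3 by (intro power_strict_mono) auto
  then have "2 * pi\<^sup>2 > 1" by simp
  then have "c * (2 * pi\<^sup>2) > c * 1" using c by (intro mult_strict_left_mono) auto
  then show "c < h" by (simp add: h_c mult_ac)
qed

lemma T_sq: "4 * T\<^sup>2 = real N * h"
  using h_pos by (simp add: Tpar_def)

lemma L_ge: "2 + \<beta> \<le> L" "2 \<le> L" "0 < L" using log_r beta by (auto simp: L_def)

lemma L_le_T: "L \<le> T" using r by (simp add: L_def)

lemma z_exp: "z = exp (of_real (2 * (L - T)) + \<i> * of_real (2 * \<theta>))"
proof -
  have "of_real r = exp (complex_of_real (2 * (L - T)))"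
    using r by (simp add: L_def exp_of_real)
  then show ?thesis by (simp add: z_def exp_add)
qed

lemma z_nonzero: "z \<noteq> 0" by (simp add: z_exp)

lemma csqrt_z: "csqrt z = exp (of_real (L - T) + \<i> * of_real \<theta>)"
proof (rule csqrt_unique)
  show "(exp (of_real (L - T) + \<i> * of_real \<theta>))\<^sup>2 = z"
    by (simp add: z_exp algebra_simps flip: exp_double)
  show "0 < Re (exp (of_real (L - T) + \<i> * of_real \<theta>)) \<or> Re (exp (of_real (L - T) + \<i> * of_real \<theta>)) = 0 \<and>
    0 \<le> Im (exp (of_real (L - T) + \<i> * of_real \<theta>))"
    using cos_theta by (simp add: Re_exp)
qed

text \<open>Write -z as an exponential with angle \<open>2 * \<theta> + pi\<close> and compare
  exponents modulo 2 pi i; halving turns the period into pi.\<close>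

lemma den_eq_0_iff: "den u = 0 \<longleftrightarrow> (\<exists>n::int. csqrt u = Complex L (\<theta> + pi / 2 + of_int n * pi))"
proof -
  have "- z = exp (of_real (2 * (L - T)) + \<i> * of_real (2 * \<theta> + pi))"
    unfolding of_real_add distrib_left by (simp add: z_exp exp_add)
  then have "den u = 0 \<longleftrightarrow>
      exp (2 * (csqrt u - of_real T)) = exp (of_real (2 * (L - T)) + \<i> * of_real (2 * \<theta> + pi))"
    by (metis add_eq_0_iff2 den_def)
  also have "\<dots> \<longleftrightarrow> (\<exists>n::int. 2 * (csqrt u - of_real T)
      = of_real (2 * (L - T)) + \<i> * of_real (2 * \<theta> + pi) + of_int (2 * n) * pi * \<i>)"
    by (simp add: exp_eq)
  also have "\<dots> \<longleftrightarrow> (\<exists>n::int. csqrt u = Complex L (\<theta> + pi / 2 + of_int n * pi))"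
    by (intro ex_cong1) (auto simp: complex_eq_iff algebra_simps)
  finally show ?thesis .
qed

lemma csqrt_pole: "csqrt (pole y) = Complex L (\<theta> + y)"
  unfolding pole_def by (rule csqrt_square) (use L_ge in auto)

lemma Re_pole: "Re (pole y) = L\<^sup>2 - (\<theta> + y)\<^sup>2" and Im_pole: "Im (pole y) = 2 * L * (\<theta> + y)"
  by (simp_all add: pole_def Re_power2 Im_power2)

lemma den_pole: "den (pole (pi / 2)) = 0" "den (pole (- pi / 2)) = 0"
  unfolding den_eq_0_iff csqrt_pole
  by (rule exI[of _ 0], simp) (rule exI[of _ "-1"], simp)

text \<open>If \<open>csqrt u\<close> is L + i y, then Im u = 2 L y, so \<open>region\<close> forces
  y below 3 pi / 2 - |theta| in absolute value. The neighbouring candidates n = 1 and n = -2 already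
  violate this.\<close>

lemma den_eq_0_region:
  assumes "u \<in> region" "den u = 0"
  shows "u \<in> {pole (pi / 2), pole (- pi / 2)}"
proof -
  obtain n :: int where n: "csqrt u = Complex L (\<theta> + pi / 2 + of_int n * pi)"
    using assms den_eq_0_iff by blast
  define y where "y = \<theta> + pi / 2 + of_int n * pi"
  have u: "u = (Complex L y)\<^sup>2" using n power2_csqrt[of u] by (simp add: y_def)
  then have "Im u = 2 * L * y" by (simp add: Im_power2)
  then have "2 * L * \<bar>y\<bar> < 2 * L * (3 * pi / 2 - \<bar>\<theta>\<bar>)"
    using assms L_ge by (simp add: region_def abs_mult)
  then have y: "\<bar>y\<bar> < 3 * pi / 2 - \<bar>\<theta>\<bar>" using L_ge by simp
  define m where "m = real_of_int n * pi"
  have "n = 0 \<or> n = -1"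
  proof (rule ccontr)
    assume "\<not> (n = 0 \<or> n = -1)"
    then consider "n \<ge> 1" | "n \<le> -2" by linarith
    then show False
    proof cases
      case 1
      then have "m \<ge> 1 * pi" unfolding m_def by (intro mult_right_mono) auto
      then show False using y theta_less unfolding y_def m_def[symmetric] by linarith
    next
      case 2
      then have "m \<le> -2 * pi" unfolding m_def by (intro mult_right_mono) auto
      then show False using y theta_less unfolding y_def m_def[symmetric] by linarith
    qed
  qed
  then show ?thesis by (auto simp: u y_def pole_def)
qed

lemma open_region: "open region" and connected_region: "connected region"
proof -
  have eq: "region = box (Complex 0 (- (2 * L * (3 * pi / 2 - \<bar>\<theta>\<bar>))))
      (Complex (real (Suc N) * h) (2 * L * (3 * pi / 2 - \<bar>\<theta>\<bar>)))"
    by (auto simp: region_def in_box_complex_iff)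
  show "open region" unfolding eq by (rule open_box)
  show "connected region" unfolding eq by (intro convex_connected convex_box)
qed

lemma region_nonpos: "u \<in> region \<Longrightarrow> u \<notin> \<real>\<^sub>\<le>\<^sub>0"
  by (auto simp: region_def complex_nonpos_Reals_iff)

text \<open>Here the lower bound on \<open>r\<close> enters. It gives L at least 2 + beta, which
  beats the imaginary part of the root, at most (2 + beta) pi / 4.\<close>

lemma pole_Re_gt: "\<bar>y\<bar> = pi / 2 \<Longrightarrow> c < Re (pole y)" "Re (pole y) < 4 * T\<^sup>2 + c"
proof -
  assume y: "\<bar>y\<bar> = pi / 2"
  have "\<bar>\<theta> + y\<bar> \<le> \<beta> * pi / 4 + pi / 2" using theta y by linarith
  also have "\<dots> = (2 + \<beta>) * (pi / 4)" by (simp add: algebra_simps)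
  \<comment> \<open>As pi / 4 < 4/5, the real part of the pole is at least 9/25 (2 + beta)^2, hence
    at least 36/25, which exceeds 1 and so \<open>c\<close>.\<close>
  also have "\<dots> \<le> (2 + \<beta>) * (4/5)"
    using beta pi_approx by (intro mult_left_mono) auto
  finally have "\<bar>\<theta> + y\<bar>\<^sup>2 \<le> ((2 + \<beta>) * (4/5))\<^sup>2" by (intro power_mono) auto
  also have "\<dots> = 16/25 * (2 + \<beta>)\<^sup>2"
    unfolding power_mult_distrib by (simp add: power_divide)
  finally have "(\<theta> + y)\<^sup>2 \<le> 16/25 * (2 + \<beta>)\<^sup>2" by simp
  moreover have "L\<^sup>2 \<ge> (2 + \<beta>)\<^sup>2" using L_ge beta by (intro power_mono) auto
  moreover have "(2 + \<beta>)\<^sup>2 \<ge> 4" using beta power_mono[of 2 "2 + \<beta>" 2] by simp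
  moreover have "\<And>x y X Y :: real. y \<le> 16/25 * X \<Longrightarrow> X \<le> Y \<Longrightarrow> 4 \<le> X \<Longrightarrow> x \<le> 1 \<Longrightarrow> x < Y - y"
    by linarith
  ultimately show "c < Re (pole y)" using c_bounds unfolding Re_pole by blast
next
  have "L\<^sup>2 \<le> T\<^sup>2" using L_le_T L_ge by (intro power_mono) auto
  moreover have "T\<^sup>2 \<le> 4 * T\<^sup>2" "L\<^sup>2 - (\<theta> + y)\<^sup>2 \<le> L\<^sup>2" by simp_all
  ultimately show "Re (pole y) < 4 * T\<^sup>2 + c"
    using c_bounds unfolding Re_pole by (smt (verit))
qed

lemma pole_Im:
  "0 < Im (pole (pi / 2))" "Im (pole (pi / 2)) < 2 * pi * L"
  "Im (pole (- pi / 2)) < 0" "- (2 * pi * L) < Im (pole (- pi / 2))"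
proof -
  have Im_up: "Im (pole (pi / 2)) = 2 * L * (\<theta> + pi / 2)"
    and Im_low: "Im (pole (- pi / 2)) = 2 * L * (\<theta> + - pi / 2)"
    by (rule Im_pole)+
  have L2: "0 < 2 * L" and comm: "2 * pi * L = 2 * L * pi" "- (2 * pi * L) = 2 * L * (- pi)"
    using L_ge by simp_all
  show "0 < Im (pole (pi / 2))"
    unfolding Im_up using theta_less by (intro mult_pos_pos L2) linarith
  show "Im (pole (- pi / 2)) < 0"
    unfolding Im_low using theta_less by (intro mult_pos_neg L2) linarith
  show "Im (pole (pi / 2)) < 2 * pi * L"
    unfolding Im_up comm using theta_less by (intro mult_strict_left_mono L2) linarith
  show "- (2 * pi * L) < Im (pole (- pi / 2))"
    unfolding Im_low comm(2) using theta_less by (intro mult_strict_left_mono L2) linarith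
qed

lemma apar_eq: "apar \<beta> N r = 2 * pi * L" by (simp add: apar_def L_def)

lemma cbox_region:
  "cbox (Complex c (- (2 * pi * L))) (Complex (4 * T\<^sup>2 + c) (2 * pi * L)) \<subseteq> region"
proof
  fix u assume "u \<in> cbox (Complex c (- (2 * pi * L))) (Complex (4 * T\<^sup>2 + c) (2 * pi * L))"
  then have u: "c \<le> Re u" "Re u \<le> real N * h + c" "\<bar>Im u\<bar> \<le> 2 * pi * L"
    using T_sq by (auto simp: in_cbox_complex_iff)
  have "2 * L * pi < 2 * L * (3 * pi / 2 - \<bar>\<theta>\<bar>)"
    using theta_less L_ge by (intro mult_strict_left_mono) auto
  then show "u \<in> region"
    using u c_bounds by (simp add: region_def algebra_simps)
qed

section \<open>Analyticity and residues\<close>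

lemma analytic_num: "u \<in> region \<Longrightarrow> num analytic_on {u}"
  unfolding num_def by (intro analytic_intros) (use region_nonpos in \<open>auto simp: region_def\<close>)

lemma analytic_den: "u \<in> region \<Longrightarrow> den analytic_on {u}"
  unfolding den_def by (intro analytic_intros) (use region_nonpos in auto)

lemma analytic_mfun:
  assumes "sin (of_real pi * u / of_real h) \<noteq> 0"
  shows "mfun \<beta> analytic_on {u}"
  unfolding mfun_def cot_def by (intro analytic_intros) (use assms h_pos in auto)

lemma num_nonzero: "u \<in> region \<Longrightarrow> num u \<noteq> 0"
  using z_nonzero by (auto simp: num_def region_def)

lemma pole_region: "pole (pi / 2) \<in> region" "pole (- pi / 2) \<in> region"
proof -
  show "pole (pi / 2) \<in> region"
    using pole_Re_gt[of "pi/2"] pole_Im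
    by (intro subsetD[OF cbox_region]) (simp add: in_cbox_complex_iff)
  show "pole (- pi / 2) \<in> region"
    using pole_Re_gt[of "-pi/2"] pole_Im
    by (intro subsetD[OF cbox_region]) (simp add: in_cbox_complex_iff)
qed

lemma den_has_derivative_pole:
  assumes "den (pole y) = 0" "pole y \<in> region"
  shows "(den has_field_derivative - z / csqrt (pole y)) (at (pole y))"
proof -
  have "exp (2 * (csqrt (pole y) - of_real T)) = - z"
    using assms(1) by (simp add: den_def eq_neg_iff_add_eq_0)
  then show ?thesis
    unfolding den_def using region_nonpos[OF assms(2)]
    by (auto intro!: derivative_eq_intros)
qed

text \<open>At a zero of \<open>den\<close> the exponential equals -z, so z and the square root
  cancel from num / den'. The weight \<open>g\<close> lets one computation serve both f (with g = 1)
  and f m.\<close>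

lemma residue_pole:
  assumes g: "g analytic_on {pole y}" "g (pole y) \<noteq> 0" and y: "den (pole y) = 0" "pole y \<in> region"
  shows "residue (\<lambda>u. fint \<beta> N u z * g u) (pole y) = - exp (csqrt (pole y) - of_real T) / of_real pi * g (pole y)"
proof -
  have nz: "csqrt (pole y) \<noteq> 0" using y(2) by (auto simp: region_def)
  have "residue (\<lambda>u. (num u * g u) / den u) (pole y) = (num (pole y) * g (pole y)) / (- z / csqrt (pole y))"
  proof (rule residue_simple_pole_deriv_analytic)
    show "(\<lambda>u. num u * g u) analytic_on {pole y}"
      using g(1) analytic_num[OF y(2)] by (rule analytic_on_mult[rotated])
    show "den analytic_on {pole y}" "den (pole y) = 0" using analytic_den y by auto
    show "(den has_field_derivative - z / csqrt (pole y)) (at (pole y))"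
      using y by (rule den_has_derivative_pole)
    show "num (pole y) * g (pole y) \<noteq> 0" using g num_nonzero[OF y(2)] by simp
    show "- z / csqrt (pole y) \<noteq> 0" using z_nonzero nz by simp
  qed
  also have "\<dots> = - exp (csqrt (pole y) - of_real T) / of_real pi * g (pole y)"
    using nz z_nonzero by (simp add: num_def field_simps)
  finally show ?thesis by (simp add: fint_eq)
qed

definition poles :: "complex set" where "poles = {pole (pi / 2), pole (- pi / 2)}"
definition nodes :: "complex set" where "nodes = (\<lambda>j. of_real (real j * h)) ` {1..N}"
definition res :: "complex \<Rightarrow> complex" where "res p = - exp (csqrt p - of_real T) / of_real pi"
definition lo :: complex where "lo = Complex c (- (2 * pi * L))"
definition hi :: complex where "hi = Complex (4 * T\<^sup>2 + c) (2 * pi * L)"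

lemma poles_distinct: "pole (pi / 2) \<noteq> pole (- pi / 2)"
  using pole_Im by (metis less_asym)

lemma T_sq_nonneg: "0 \<le> 4 * T\<^sup>2" by simp

lemma lo_le_hi: "Re lo \<le> Re hi" "Im lo \<le> Im hi" "Re lo = c" "Im lo = - (2 * pi * L)"
  "Re hi = 4 * T\<^sup>2 + c" "Im hi = 2 * pi * L"
  using L_ge by (auto simp: lo_def hi_def)

lemma poles_box: "poles \<subseteq> box lo hi"
  using pole_Re_gt[of "pi/2"] pole_Re_gt[of "-pi/2"] pole_Im L_ge
  by (auto simp: poles_def in_box_complex_iff lo_le_hi)

lemma nodes_box: "nodes \<subseteq> box lo hi"
proof
  fix u assume "u \<in> nodes"
  then obtain j where j: "1 \<le> j" "j \<le> N" "u = of_real (real j * h)" by (auto simp: nodes_def)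
  have "1 * h \<le> real j * h" "real j * h \<le> real N * h" using j h_pos by (intro mult_right_mono; simp)+
  then have "c < real j * h" "real j * h < 4 * T\<^sup>2 + c" unfolding T_sq using c_bounds by linarith+
  then show "u \<in> box lo hi"
    using j(3) L_ge by (simp add: in_box_complex_iff lo_le_hi)
qed

lemma cbox_lo_hi: "cbox lo hi \<subseteq> region" using cbox_region by (simp add: lo_def hi_def)

lemma box_lo_hi: "box lo hi \<subseteq> region" using cbox_lo_hi box_subset_cbox by blast

lemma poles_nodes_disjoint: "poles \<inter> nodes = {}"
  using pole_Im by (auto simp: poles_def nodes_def)

lemma den_nonzero: "u \<in> region - poles \<Longrightarrow> den u \<noteq> 0"
  using den_eq_0_region by (auto simp: poles_def)

text \<open>The zeros are the integer multiples of h, and the bounds on \<open>Re u\<close> in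
  \<open>region\<close> leave exactly the multiples 1 to N.\<close>

lemma sin_nonzero:
  assumes "u \<in> region - nodes"
  shows "sin (of_real pi * u / of_real h) \<noteq> 0"
proof
  assume "sin (of_real pi * u / of_real h) = 0"
  then obtain n :: int where "of_real pi * u / of_real h = of_real (n * pi)"
    using sin_eq_0 by auto
  then have "of_real pi * u = of_real pi * of_real (real_of_int n * h)"
    using h_pos by (simp add: field_simps)
  then have u: "u = of_real (real_of_int n * h)" by simp
  then have "0 < real_of_int n * h" "real_of_int n * h < real (Suc N) * h"
    using assms by (auto simp: region_def)
  then have n: "0 < n" "real_of_int n < real (Suc N)"
    using h_pos by (auto simp: zero_less_mult_iff simp del: of_nat_Suc)
  then have "u = of_real (real (nat n) * h)" "nat n \<in> {1..N}" using u by auto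
  then have "u \<in> nodes" unfolding nodes_def by blast
  then show False using assms by simp
qed

lemma analytic_fint: "u \<in> region - poles \<Longrightarrow> (\<lambda>u. fint \<beta> N u z) analytic_on {u}"
  unfolding fint_eq using den_nonzero
  by (intro analytic_intros analytic_num analytic_den) auto

lemma holomorphic_fint: "(\<lambda>u. fint \<beta> N u z) holomorphic_on region - poles"
  using analytic_fint by (intro analytic_imp_holomorphic) (metis analytic_on_analytic_at)

lemma holomorphic_fint_mfun: "(\<lambda>u. fint \<beta> N u z * mfun \<beta> u) holomorphic_on region - (poles \<union> nodes)"
proof (intro holomorphic_on_mult)
  show "(\<lambda>u. fint \<beta> N u z) holomorphic_on region - (poles \<union> nodes)"
    using holomorphic_fint by (rule holomorphic_on_subset) auto
  show "mfun \<beta> holomorphic_on region - (poles \<union> nodes)"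
    using analytic_mfun sin_nonzero
    by (intro analytic_imp_holomorphic) (subst analytic_on_analytic_at, auto)
qed

text \<open>Supplies the nonvanishing weight for \<open>residue_pole\<close>: sine and cosine have
  real zeros only.\<close>

lemma mfun_nonzero:
  assumes "Im u \<noteq> 0"
  shows "mfun \<beta> u \<noteq> 0"
proof
  assume "mfun \<beta> u = 0"
  \<comment> \<open>The first alternative arises because division by zero makes \<open>cot\<close>
    vanish at the zeros of the sine.\<close>
  then have "sin (of_real pi * u / of_real h) = 0 \<or> cos (of_real pi * u / of_real h) = 0"
    by (auto simp: mfun_def cot_def)
  then have "Im (of_real pi * u / of_real h) = 0"
    unfolding sin_eq_0 cos_eq_0 by (elim disjE exE) (simp_all only: Im_complex_of_real plus_complex.simps, simp_all)
  then show False using assms h_pos by simp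
qed

lemma residue_fint_mfun_pole:
  assumes "p \<in> poles"
  shows "residue (\<lambda>u. fint \<beta> N u z * mfun \<beta> u) p = res p * mfun \<beta> p"
proof -
  obtain y where y: "p = pole y" using assms by (auto simp: poles_def)
  have "p \<in> region - nodes" using assms pole_region poles_nodes_disjoint by (auto simp: poles_def)
  moreover have "Im p \<noteq> 0" using assms pole_Im by (auto simp: poles_def)
  moreover have "den p = 0" using assms den_pole by (auto simp: poles_def)
  ultimately show ?thesis
    unfolding res_def y
    by (intro residue_pole analytic_mfun sin_nonzero mfun_nonzero) auto
qed

lemma residue_fint_pole:
  assumes "p \<in> poles"
  shows "residue (\<lambda>u. fint \<beta> N u z) p = res p"
proof -
  obtain y where y: "p = pole y" using assms by (auto simp: poles_def)
  have "p \<in> region" "den p = 0" using assms den_pole pole_region by (auto simp: poles_def)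
  then show ?thesis
    using residue_pole[of "\<lambda>_. 1" y] unfolding res_def y by simp
qed

text \<open>The derivative of the sine contributes pi / h times the cosine, which cancels.
  Multiplied by 2 pi i the residue is h f(j h), one term of the quadrature sum.\<close>

lemma residue_fint_mfun_node:
  assumes "j \<in> {1..N}"
  defines "u \<equiv> of_real (real j * h)"
  shows "residue (\<lambda>u. fint \<beta> N u z * mfun \<beta> u) u = fint \<beta> N u z * (- \<i> / 2 * (h / pi))"
proof -
  define w where "w = (\<lambda>u. complex_of_real pi * u / complex_of_real h)"
  have wu: "w u = of_real (real j * pi)" using h_pos by (simp add: w_def u_def)
  have u: "u \<in> nodes" using assms by (auto simp: nodes_def)
  then have reg: "u \<in> region - poles"
    using nodes_box box_lo_hi poles_nodes_disjoint by blast
  have sin0: "sin (w u) = 0" unfolding wu sin_of_real by simp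
  have cos1: "cos (w u) \<noteq> 0"
    using sin_cos_squared_add[of "w u"] sin0 by auto
  have fnz: "fint \<beta> N u z \<noteq> 0" using reg num_nonzero den_nonzero by (simp add: fint_eq)
  have "residue (\<lambda>u. (fint \<beta> N u z * (- \<i> / 2 * cos (w u))) / sin (w u)) u
     = (fint \<beta> N u z * (- \<i> / 2 * cos (w u))) / (cos (w u) * (pi / h))"
  proof (rule residue_simple_pole_deriv_analytic)
    show "(\<lambda>u. fint \<beta> N u z * (- \<i> / 2 * cos (w u))) analytic_on {u}"
      unfolding w_def using analytic_fint[OF reg] h_pos by (intro analytic_intros) auto
    show "(\<lambda>u. sin (w u)) analytic_on {u}"
      unfolding w_def using h_pos by (intro analytic_intros) auto
    show "((\<lambda>u. sin (w u)) has_field_derivative cos (w u) * (pi / h)) (at u)"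
      unfolding w_def using h_pos by (auto intro!: derivative_eq_intros)
  qed (use fnz cos1 sin0 h_pos in auto)
  also have "(\<lambda>u. (fint \<beta> N u z * (- \<i> / 2 * cos (w u))) / sin (w u)) = (\<lambda>u. fint \<beta> N u z * mfun \<beta> u)"
    by (simp add: mfun_def cot_def w_def)
  also have "(fint \<beta> N u z * (- \<i> / 2 * cos (w u))) / (cos (w u) * (pi / h)) = fint \<beta> N u z * (- \<i> / 2 * (h / pi))"
    using cos1 by simp
  finally show ?thesis .
qed

lemma fint_node: "fint \<beta> N (of_real (real j * h)) z
  = z / of_real pi * (complex_of_real (1 / sqrt (real j * h)) *
        (complex_of_real (exp (sqrt (real j * h) - sqrt (real N * h / 4))) /
         (complex_of_real (exp (2 * sqrt (real j * h) - 2 * sqrt (real N * h / 4))) + z)))"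
proof -
  have "csqrt (of_real (real j * h)) = of_real (sqrt (real j * h))"
    using h_pos by (intro csqrt_of_real) auto
  then show ?thesis
    unfolding fint_def Tpar_def
    by (simp add: right_diff_distrib flip: exp_of_real)
qed

lemma r_t_eq: "r_t \<beta> N z = (\<Sum>j=1..N. of_real h * fint \<beta> N (of_real (real j * h)) z)"
  unfolding r_t_def sum_distrib_left fint_node by (intro sum.cong) (auto simp: field_simps)

lemma rectpath_disjoint: "A \<subseteq> box lo hi \<Longrightarrow> path_image (rectpath lo hi) \<inter> A = {}"
  using path_image_rectpath_inter_box[OF lo_le_hi(1,2)] by blast

lemma finite_poles: "finite poles" and finite_nodes: "finite nodes"
  by (auto simp: poles_def nodes_def)

section \<open>The three integrals around the contour\<close>

lemma contour_integral_fint_mfun: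
  "contour_integral (rectpath lo hi) (\<lambda>u. fint \<beta> N u z * mfun \<beta> u)
     = r_t \<beta> N z + 2 * pi * \<i> * (\<Sum>p\<in>poles. res p * mfun \<beta> p)"
proof -
  let ?f = "\<lambda>u. fint \<beta> N u z * mfun \<beta> u"
  have "contour_integral (rectpath lo hi) ?f
      = 2 * pi * \<i> * (\<Sum>p\<in>(poles \<union> nodes) \<inter> box lo hi. residue ?f p)"
    using cbox_lo_hi holomorphic_fint_mfun finite_poles finite_nodes poles_box nodes_box
    by (intro contour_integral_rectpath_residues[OF open_region connected_region] lo_le_hi(1,2) rectpath_disjoint) auto
  also have "(poles \<union> nodes) \<inter> box lo hi = poles \<union> nodes" using poles_box nodes_box by auto
  also have "(\<Sum>p\<in>poles \<union> nodes. residue ?f p) = (\<Sum>p\<in>poles. residue ?f p) + (\<Sum>p\<in>nodes. residue ?f p)"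
    using poles_nodes_disjoint finite_poles finite_nodes by (intro sum.union_disjoint) auto
  also have "(\<Sum>p\<in>poles. residue ?f p) = (\<Sum>p\<in>poles. res p * mfun \<beta> p)"
    by (intro sum.cong residue_fint_mfun_pole) auto
  also have "(\<Sum>p\<in>nodes. residue ?f p) = (\<Sum>j=1..N. residue ?f (of_real (real j * h)))"
    unfolding nodes_def using h_pos by (subst sum.reindex) (auto simp: inj_on_def)
  also have "\<dots> = (\<Sum>j=1..N. fint \<beta> N (of_real (real j * h)) z * (- \<i> / 2 * (h / pi)))"
    by (intro sum.cong residue_fint_mfun_node) auto
  also have "2 * pi * \<i> * ((\<Sum>p\<in>poles. res p * mfun \<beta> p) + \<dots>)
      = (\<Sum>j=1..N. 2 * pi * \<i> * (fint \<beta> N (of_real (real j * h)) z * (- \<i> / 2 * (h / pi)))) + 2 * pi * \<i> * (\<Sum>p\<in>poles. res p * mfun \<beta> p)"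
    by (simp only: distrib_left sum_distrib_left add.commute)
  also have "(\<Sum>j=1..N. 2 * pi * \<i> * (fint \<beta> N (of_real (real j * h)) z * (- \<i> / 2 * (h / pi)))) = r_t \<beta> N z"
    unfolding r_t_eq by (intro sum.cong) (auto simp: field_simps)
  finally show ?thesis .
qed

text \<open>Each half of the rectangle contains one pole. The weights 1/2 for the lower and -1/2 for
  the upper half are the values of \<open>mu\<close> at these poles.\<close>

lemma contour_integral_fint_mu:
  "((\<lambda>u. fint \<beta> N u z * mu u) has_contour_integral
     contour_integral (linepath (Complex c 0) (Complex (4 * T\<^sup>2 + c) 0)) (\<lambda>u. fint \<beta> N u z)
     + 2 * pi * \<i> * (\<Sum>p\<in>poles. res p * mu p)) (rectpath lo hi)"
proof -
  let ?f = "\<lambda>u. fint \<beta> N u z"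
  let ?A = "2 * pi * L" and ?x = "4 * T\<^sup>2 + c"
  let ?K = "{u. Re u \<in> {c..?x} \<and> Im u \<in> {- ?A, 0, ?A}} \<union> {u. Re u \<in> {c, ?x} \<and> Im u \<in> {- ?A..?A}}"
  \<comment> \<open>Stated for a general strip so that it covers both the upper and the lower half;
    the assumption on \<open>p\<close> says that the strip holds a single pole.\<close>
  have half: "contour_integral (rectpath (Complex c s) (Complex ?x t)) ?f = 2 * pi * \<i> * res p"
    if st: "s \<le> t" "- ?A \<le> s" "t \<le> ?A" "s = - ?A \<or> s = 0" "t = 0 \<or> t = ?A"
      and p: "poles \<inter> {u. s < Im u \<and> Im u < t} = {p}" for s t p
  proof -
    have "contour_integral (rectpath (Complex c s) (Complex ?x t)) ?f
        = 2 * pi * \<i> * (\<Sum>p\<in>poles \<inter> box (Complex c s) (Complex ?x t). residue ?f p)"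
    proof (rule contour_integral_rectpath_residues[OF open_region connected_region _ finite_poles holomorphic_fint])
      show "cbox (Complex c s) (Complex ?x t) \<subseteq> region"
        using cbox_lo_hi st by (auto simp: in_cbox_complex_iff lo_le_hi subset_iff)
      show "path_image (rectpath (Complex c s) (Complex ?x t)) \<inter> poles = {}"
        using st poles_box pole_Im L_ge
        by (subst path_image_rectpath) (auto simp: poles_def in_box_complex_iff lo_le_hi)
    qed (use st in auto)
    also have "poles \<inter> box (Complex c s) (Complex ?x t) = {p}"
    proof -
      have "poles \<inter> box (Complex c s) (Complex ?x t) = poles \<inter> {u. s < Im u \<and> Im u < t}"
        using poles_box by (auto simp: in_box_complex_iff lo_le_hi)
      then show ?thesis using p by simp
    qed
    finally show ?thesis using p residue_fint_pole[of p] by auto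
  qed
  have up: "contour_integral (rectpath (Complex c 0) (Complex ?x ?A)) ?f = 2 * pi * \<i> * res (pole (pi / 2))"
    using pole_Im L_ge by (intro half) (auto simp: poles_def)
  have low: "contour_integral (rectpath (Complex c (- ?A)) (Complex ?x 0)) ?f = 2 * pi * \<i> * res (pole (- pi / 2))"
    using pole_Im L_ge by (intro half) (auto simp: poles_def)
  have "continuous_on (region - poles) ?f"
    using holomorphic_fint by (rule holomorphic_on_imp_continuous_on)
  moreover have "?K \<subseteq> region - poles"
    using pole_Im L_ge pole_Re_gt[of "pi/2"] pole_Re_gt[of "-pi/2"]
    by (auto simp: poles_def intro!: subsetD[OF cbox_lo_hi] simp: in_cbox_complex_iff lo_le_hi)
  ultimately have "continuous_on ?K ?f" by (rule continuous_on_subset)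
  then have main: "((\<lambda>u. ?f u * mu u) has_contour_integral
           (contour_integral (linepath (Complex c 0) (Complex ?x 0)) ?f
            + contour_integral (rectpath (Complex c (- ?A)) (Complex ?x 0)) ?f / 2
            - contour_integral (rectpath (Complex c 0) (Complex ?x ?A)) ?f / 2))
         (rectpath (Complex c (- ?A)) (Complex ?x ?A))"
    using L_ge by (intro has_contour_integral_rectpath_mu) auto
  have sum: "(\<Sum>p\<in>poles. res p * mu p) = res (pole (- pi / 2)) / 2 - res (pole (pi / 2)) / 2"
    using poles_distinct pole_Im by (simp add: poles_def mu_def)
  have eq: "I + 2 * pi * \<i> * a / 2 - 2 * pi * \<i> * b / 2 = I + 2 * pi * \<i> * (a / 2 - b / 2)" for I a b :: complex
    by (simp add: right_diff_distrib)
  show ?thesis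
    using main unfolding up low sum lo_def hi_def eq .
qed

lemma contour_integral_fint_delta:
  "contour_integral (rectpath lo hi) (\<lambda>u. fint \<beta> N u z * delta \<beta> u)
   = contour_integral (linepath (Complex c 0) (Complex (4 * T\<^sup>2 + c) 0)) (\<lambda>u. fint \<beta> N u z)
     - r_t \<beta> N z + 2 * pi * \<i> * (\<Sum>p\<in>poles. res p * delta \<beta> p)"
proof -
  have "(\<lambda>u. fint \<beta> N u z * mfun \<beta> u) contour_integrable_on rectpath lo hi"
  proof (rule contour_integrable_holomorphic_simple[OF holomorphic_fint_mfun])
    show "open (region - (poles \<union> nodes))"
      using finite_poles finite_nodes open_region by (intro open_Diff finite_imp_closed) auto
    show "path_image (rectpath lo hi) \<subseteq> region - (poles \<union> nodes)"
      using path_image_rectpath_subset_cbox[OF lo_le_hi(1,2)] cbox_lo_hi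
        rectpath_disjoint[OF poles_box] rectpath_disjoint[OF nodes_box] by blast
  qed auto
  then have "((\<lambda>u. fint \<beta> N u z * mfun \<beta> u) has_contour_integral
      (r_t \<beta> N z + 2 * pi * \<i> * (\<Sum>p\<in>poles. res p * mfun \<beta> p))) (rectpath lo hi)"
    using contour_integral_fint_mfun has_contour_integral_integral by metis
  from contour_integral_unique[OF has_contour_integral_diff[OF contour_integral_fint_mu this]]
  show ?thesis
    by (simp add: delta_def right_diff_distrib sum_subtractf)
qed

section \<open>The integral along the real segment\<close>

definition w :: "real \<Rightarrow> complex" where "w x = of_real (exp (sqrt x - L)) * exp (\<i> * of_real (- \<theta>))"
text \<open>The substitution v = exp (sqrt u - T) / sqrt z turns f du into (2 sqrt z / pi) dv / (1 +
  v^2). For positive real u the value of v is \<open>w u\<close>, whose positive real part keeps it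
  off the cuts of \<open>Arctan\<close>.\<close>

definition primitive :: "complex \<Rightarrow> complex"
  where "primitive u = 2 * csqrt z / pi * Arctan (exp (csqrt u - of_real T) / csqrt z)"

lemma exp_csqrt_div:
  assumes "0 \<le> x"
  shows "exp (csqrt (of_real x) - of_real T) / csqrt z = w x"
proof -
  have "exp (csqrt (of_real x) - of_real T) / csqrt z
      = exp (of_real (sqrt x) - of_real T - (of_real (L - T) + \<i> * of_real \<theta>))"
    unfolding csqrt_z csqrt_of_real[OF assms] exp_diff ..
  also have "of_real (sqrt x) - of_real T - (of_real (L - T) + \<i> * of_real \<theta>)
      = of_real (sqrt x - L) + \<i> * of_real (- \<theta>)" by simp
  finally show ?thesis by (simp only: w_def exp_add exp_of_real)
qed

lemma Re_w: "Re (w x) > 0" using cos_theta by (simp add: w_def Re_exp)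

lemma primitive_has_derivative:
  assumes "0 < x"
  shows "(primitive has_field_derivative fint \<beta> N (of_real x) z) (at (of_real x))"
proof -
  let ?u = "complex_of_real x"
  define E where "E = exp (csqrt ?u - of_real T)"
  define q where "q = csqrt z"
  have q: "q \<noteq> 0" "z = q\<^sup>2" using z_nonzero by (auto simp: q_def)
  have nonpos: "?u \<notin> \<real>\<^sub>\<le>\<^sub>0" using assms by simp
  have Rew: "Re (E / q) > 0" using exp_csqrt_div[of x] Re_w assms by (simp add: E_def q_def)
  have E2: "exp (2 * (csqrt ?u - of_real T)) = E\<^sup>2" unfolding E_def by (rule exp_double)
  have inner: "((\<lambda>u. exp (csqrt u - of_real T) / q) has_field_derivative E / q / (2 * csqrt ?u)) (at ?u)"
    unfolding E_def using nonpos q(1) by (auto intro!: derivative_eq_intros)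
  have "(Arctan has_field_derivative inverse (1 + (E / q)\<^sup>2)) (at (E / q))"
    using Rew by (intro has_field_derivative_Arctan) auto
  from DERIV_chain2[OF this[unfolded E_def] inner]
  have "((\<lambda>u. 2 * q / pi * Arctan (exp (csqrt u - of_real T) / q)) has_field_derivative
      2 * q / pi * (inverse (1 + (E / q)\<^sup>2) * (E / q / (2 * csqrt ?u)))) (at ?u)"
    unfolding E_def[symmetric] by (rule DERIV_cmult)
  moreover have "2 * q / pi * (inverse (1 + (E / q)\<^sup>2) * (E / q / (2 * csqrt ?u))) = fint \<beta> N ?u z"
  proof -
    have "1 + (E / q)\<^sup>2 = (E\<^sup>2 + q\<^sup>2) / q\<^sup>2" using q by (simp add: field_simps)
    then show ?thesis
      using q assms unfolding fint_def E2 E_def[symmetric] q(2)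
      by (simp add: power2_eq_square mult_ac)
  qed
  ultimately show ?thesis by (simp add: primitive_def[abs_def] q_def)
qed

lemma contour_integral_fint_real:
  "contour_integral (linepath (Complex c 0) (Complex (4 * T\<^sup>2 + c) 0)) (\<lambda>u. fint \<beta> N u z)
    = primitive (of_real (4 * T\<^sup>2 + c)) - primitive (of_real c)"
proof (rule contour_integral_unique)
  let ?g = "linepath (Complex c 0) (Complex (4 * T\<^sup>2 + c) 0)"
  have "((\<lambda>u. fint \<beta> N u z) has_contour_integral primitive (pathfinish ?g) - primitive (pathstart ?g)) ?g"
  \<comment> \<open>The path stays on the positive real axis, so a derivative within that set is
    enough.\<close>
  proof (rule contour_integral_primitive[where S="of_real ` {0<..}"])
    show "path_image ?g \<subseteq> of_real ` {0<..}"
    proof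
      fix u assume "u \<in> path_image ?g"
      then have "Im u = 0" "c \<le> Re u"
        using T_sq_nonneg by (auto simp: closed_segment_same_Im closed_segment_eq_real_ivl)
      then show "u \<in> of_real ` {0<..}"
        using c_bounds by (intro image_eqI[of _ _ "Re u"]) (auto simp: complex_eq_iff)
    qed
  next
    fix u assume "u \<in> complex_of_real ` {0<..}"
    then show "(primitive has_field_derivative fint \<beta> N u z) (at u within of_real ` {0<..})"
      using primitive_has_derivative has_field_derivative_at_within by fastforce
  qed simp
  then show "((\<lambda>u. fint \<beta> N u z) has_contour_integral primitive (of_real (4 * T\<^sup>2 + c)) - primitive (of_real c)) ?g"
    by (simp add: complex_of_real_def)
qed

text \<open>At the right end \<open>Arctan\<close> is pi / 2 minus the arctangent of the inverse,
  and the part pi / 2 yields exactly \<open>csqrt z\<close>. What is left are two arctangents of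
  small arguments.\<close>

lemma norm_integral_minus_csqrt:
  "norm (contour_integral (linepath (Complex c 0) (Complex (4 * T\<^sup>2 + c) 0)) (\<lambda>u. fint \<beta> N u z) - csqrt z)
    \<le> (1 + exp 1) / cos \<theta> * exp (- T)"
proof -
  define x where "x = 4 * T\<^sup>2 + c"
  have x: "0 \<le> x" using c_bounds T_sq_nonneg unfolding x_def by linarith
  \<comment> \<open>Makes the right end contribute exp (2 L - T - sqrt x), at most exp (- T); the
    left end contributes exp (sqrt c - T), at most exp (1 - T).\<close>
  have sx: "2 * L \<le> sqrt x"
  proof (rule real_le_rsqrt)
    have "(2 * L)\<^sup>2 \<le> (2 * T)\<^sup>2" using L_le_T L_ge by (intro power_mono) auto
    then show "(2 * L)\<^sup>2 \<le> x" using c_bounds by (simp add: x_def power_mult_distrib)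
  qed
  have sc: "sqrt c \<le> 1" using c_bounds by simp
  have nq: "norm (csqrt z) = exp (L - T)" unfolding csqrt_z by simp
  have wx: "inverse (w x) = of_real (exp (L - sqrt x)) * exp (\<i> * of_real \<theta>)"
    by (simp add: w_def exp_minus[symmetric] flip: of_real_inverse)
  have "primitive (of_real x) - primitive (of_real c) - csqrt z
      = 2 * csqrt z / pi * (Arctan (w x) - Arctan (w c) - of_real (pi / 2))"
    using x c_bounds unfolding primitive_def
    by (simp only: exp_csqrt_div less_imp_le) (simp add: field_simps)
  also have "\<dots> = - (2 * csqrt z / pi * (Arctan (inverse (w x)) + Arctan (w c)))"
    unfolding Arctan_add_Arctan_inverse[OF Re_w, of x, symmetric] by (simp add: algebra_simps)
  finally have "norm (primitive (of_real x) - primitive (of_real c) - csqrt z)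
      = 2 / pi * exp (L - T) * norm (Arctan (inverse (w x)) + Arctan (w c))"
    by (simp add: norm_mult norm_divide nq del: norm_csqrt)
  also have "\<dots> \<le> 1 * exp (L - T) * (exp (L - sqrt x) / cos \<theta> + exp (sqrt c - L) / cos \<theta>)"
  proof (intro mult_mono order_trans[OF norm_triangle_ineq] add_mono)
    show "norm (Arctan (inverse (w x))) \<le> exp (L - sqrt x) / cos \<theta>"
      unfolding wx using cos_theta by (intro norm_Arctan_le) auto
    show "norm (Arctan (w c)) \<le> exp (sqrt c - L) / cos \<theta>"
      unfolding w_def using norm_Arctan_le[of "exp (sqrt c - L)" "- \<theta>"] cos_theta by simp
    show "2 / pi \<le> 1" using pi_ge_two by simp
  qed auto
  also have "\<dots> = (exp (2 * L - T - sqrt x) + exp (sqrt c - T)) / cos \<theta>"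
    by (simp add: add_divide_distrib distrib_left mult_exp_exp)
  also have "\<dots> \<le> (exp (- T) + exp (1 - T)) / cos \<theta>"
    using sx sc cos_theta by (intro divide_right_mono add_mono) auto
  also have "exp (- T) + exp (1 - T) = (1 + exp 1) * exp (- T)"
    by (simp add: distrib_right mult_exp_exp)
  finally show ?thesis unfolding contour_integral_fint_real unfolding x_def by simp
qed

section \<open>The error for \<open>r\<close> in the range of the hypothesis\<close>

text \<open>The residue has modulus exp (L - T) / pi, and the choice of h makes \<open>delta\<close>
  decay at the poles like exp (- L), so that L cancels.\<close>

lemma norm_res_delta:
  assumes "p \<in> poles"
  shows "norm (res p * delta \<beta> p) \<le> 2 / pi * exp (- T)"
proof -
  obtain y where y: "p = pole y" "\<bar>y\<bar> = pi / 2" using assms by (auto simp: poles_def)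
  have "pi / 2 - \<bar>\<theta>\<bar> \<le> \<bar>\<theta> + y\<bar>" using y(2) by linarith
  then have "2 * L * (pi / 2 - \<bar>\<theta>\<bar>) \<le> \<bar>Im p\<bar>"
    using L_ge by (simp add: y(1) Im_pole abs_mult)
  then have "2 * pi * (2 * L * (pi / 2 - \<bar>\<theta>\<bar>)) / h \<le> 2 * pi * \<bar>Im p\<bar> / h"
    using h_pos by (intro divide_right_mono mult_left_mono) auto
  \<comment> \<open>The purpose of h = (2 - beta) pi^2: it equals 4 pi times the distance pi / 2 -
    |theta|.\<close>
  moreover have "2 * pi * (2 * L * (pi / 2 - \<bar>\<theta>\<bar>)) / h = L"
    using beta unfolding theta hpar_def by (simp add: field_simps power2_eq_square)
  ultimately have "norm (delta \<beta> p) \<le> 2 * exp (- L)"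
    using L_ge h_pos by (intro norm_delta_le) auto
  moreover have "norm (res p) = exp (L - T) / pi"
    by (simp add: res_def y(1) csqrt_pole norm_divide)
  ultimately have "norm (res p * delta \<beta> p) \<le> exp (L - T) / pi * (2 * exp (- L))"
    unfolding norm_mult by (intro mult_mono) auto
  also have "\<dots> = 2 / pi * exp (- T)" by (simp add: mult_exp_exp)
  finally show ?thesis .
qed

lemma norm_r_t_minus_csqrt:
  "norm (r_t \<beta> N z - csqrt z)
    \<le> norm (contour_integral (Gamma \<beta> N r) (\<lambda>u. fint \<beta> N u z * delta \<beta> u))
      + (8 + (1 + exp 1) / cos \<theta>) * exp (- T)"
proof -
  let ?I = "contour_integral (linepath (Complex c 0) (Complex (4 * T\<^sup>2 + c) 0)) (\<lambda>u. fint \<beta> N u z)"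
  let ?G = "contour_integral (Gamma \<beta> N r) (\<lambda>u. fint \<beta> N u z * delta \<beta> u)"
  let ?S = "\<Sum>p\<in>poles. res p * delta \<beta> p"
  have "Gamma \<beta> N r = rectpath lo hi"
    by (simp add: Gamma_def apar_eq lo_def hi_def c_def add_diff_eq)
  then have eq: "r_t \<beta> N z - csqrt z = (?I - csqrt z) - ?G + 2 * pi * \<i> * ?S"
    using contour_integral_fint_delta by (simp add: algebra_simps)
  have "norm ?S \<le> (\<Sum>p\<in>poles. 2 / pi * exp (- T))"
    by (rule sum_norm_le) (rule norm_res_delta)
  also have "\<dots> = 4 / pi * exp (- T)" using poles_distinct by (simp add: poles_def)
  finally have "2 * pi * norm ?S \<le> 2 * pi * (4 / pi * exp (- T))"
    by (intro mult_left_mono) auto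
  \<comment> \<open>The constant 8 is 2 pi times two poles times 2 / pi.\<close>
  then have S: "norm (2 * pi * \<i> * ?S) \<le> 8 * exp (- T)" by (simp add: norm_mult)
  have "norm (r_t \<beta> N z - csqrt z) \<le> norm (?I - csqrt z) + norm ?G + norm (2 * pi * \<i> * ?S)"
    unfolding eq by (intro order_trans[OF norm_triangle_ineq] add_right_mono norm_triangle_ineq4)
  then show ?thesis using S norm_integral_minus_csqrt by (simp add: distrib_right)
qed

end

section \<open>The error for small \<open>r\<close>\<close>

lemma norm_r_t_minus_csqrt_small:
  fixes \<beta> \<theta> r B :: real and N :: nat
  assumes beta: "\<beta> < 2" and cos: "cos \<theta> > 0" and r: "0 \<le> r" "r \<le> exp (2 * B - 2 * Tpar \<beta> N)"
  defines "z \<equiv> of_real r * exp (\<i> * of_real (2 * \<theta>))"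
  shows "norm (r_t \<beta> N z - csqrt z) \<le> (exp (2 * B) / cos \<theta> + exp B) * exp (- Tpar \<beta> N)"
proof -
  let ?h = "hpar \<beta>" and ?T = "Tpar \<beta> N"
  let ?s = "\<lambda>j::nat. sqrt (real j * ?h)"
  have h: "?h > 0" using beta by (simp add: hpar_def)
  have nz: "norm z = r" using r by (simp add: z_def norm_mult)
  have summand: "norm (complex_of_real (1 / ?s j) * (of_real (exp (?s j - ?T)) / (of_real (exp (2 * ?s j - 2 * ?T)) + z)))
      \<le> 1 / ?s j * exp (- ?s j) * (exp ?T / cos \<theta>)" for j
  proof -
    let ?d = "complex_of_real (exp (2 * ?s j - 2 * ?T)) + z"
    \<comment> \<open>Dropping \<open>r\<close> from the lower bound leaves summands of the shape
      treated by \<open>sum_exp_minus_sqrt_le\<close>, with the common factor exp T / cos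
      theta.\<close>
    have "exp (2 * ?s j - 2 * ?T) * cos \<theta> \<le> (exp (2 * ?s j - 2 * ?T) + r) * cos \<theta>"
      using r cos by (intro mult_right_mono) auto
    also have "\<dots> \<le> norm ?d"
      unfolding z_def using r by (intro norm_of_real_add_cis_ge) auto
    finally have d: "exp (2 * ?s j - 2 * ?T) * cos \<theta> \<le> norm ?d" .
    have "exp (?s j - ?T) / norm ?d \<le> exp (?s j - ?T) / (exp (2 * ?s j - 2 * ?T) * cos \<theta>)"
      using cos by (intro divide_left_mono[OF d]) (auto intro!: mult_pos_pos order_less_le_trans[OF _ d])
    also have "\<dots> = exp (- ?s j) * (exp ?T / cos \<theta>)"
    proof -
      have "exp (?s j - ?T) = exp (2 * ?s j - 2 * ?T) * (exp (- ?s j) * exp ?T)"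
        by (simp add: mult_exp_exp)
      then show ?thesis by (simp only: divide_divide_eq_left[symmetric]) simp
    qed
    finally have "1 / ?s j * (exp (?s j - ?T) / norm ?d) \<le> 1 / ?s j * (exp (- ?s j) * (exp ?T / cos \<theta>))"
      using h by (intro mult_left_mono) auto
    moreover have "0 \<le> ?s j" using h by simp
    ultimately show ?thesis by (simp add: norm_mult norm_divide mult.assoc)
  qed
  have "norm (r_t \<beta> N z) \<le> r * (?h / pi) * (\<Sum>j=1..N. 1 / ?s j * exp (- ?s j) * (exp ?T / cos \<theta>))"
    unfolding r_t_def norm_mult nz Tpar_def[symmetric]
    using r h by (intro mult_mono sum_norm_le summand) (auto intro!: sum_nonneg simp: norm_divide)
  also have "\<dots> = r * exp ?T / (pi * cos \<theta>) * (\<Sum>j=1..N. ?h / ?s j * exp (- ?s j))"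
    unfolding sum_distrib_left by (intro sum.cong) (auto simp: mult_ac)
  also have "\<dots> \<le> r * exp ?T / (pi * cos \<theta>) * 2"
    using r cos h by (intro mult_left_mono sum_exp_minus_sqrt_le) auto
  also have "\<dots> = (2 / pi) * (r * exp ?T / cos \<theta>)" by simp
  also have "\<dots> \<le> 1 * (exp (2 * B - 2 * ?T) * exp ?T / cos \<theta>)"
    using r cos pi_ge_two by (intro mult_mono divide_right_mono mult_right_mono) auto
  also have "\<dots> = exp (2 * B) / cos \<theta> * exp (- ?T)"
    by (simp add: mult_exp_exp)
  finally have 1: "norm (r_t \<beta> N z) \<le> exp (2 * B) / cos \<theta> * exp (- ?T)" .
  have "norm (csqrt z) = sqrt r" by (simp add: nz)
  also have "\<dots> \<le> sqrt ((exp (B - ?T))\<^sup>2)"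
    using r by (intro real_sqrt_le_mono) (simp add: right_diff_distrib flip: exp_double)
  also have "\<dots> = exp B * exp (- ?T)" by (simp add: mult_exp_exp)
  finally have "norm (csqrt z) \<le> exp B * exp (- ?T)" .
  with 1 show ?thesis
    using norm_triangle_ineq4[of "r_t \<beta> N z" "csqrt z"] by (simp add: distrib_right)
qed

section \<open>Uniform bound on both rays\<close>

theorem theorem5p1:
  fixes \<beta> :: real
  assumes "0 \<le> \<beta>" and "\<beta> < 2"
  assumes "\<exists>K. \<forall>\<^sub>F N in sequentially.
             \<forall>r \<in> {exp (4 + 2*\<beta> - 2 * Tpar \<beta> N) .. 1}. \<forall>s \<in> {1, -1::real}.
               cmod (contour_integral (Gamma \<beta> N r)
                  (\<lambda>u. fint \<beta> N u (complex_of_real r * exp (\<i> * complex_of_real (s * \<beta> * pi / 2)))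
                        * delta \<beta> u))
               \<le> K * exp (- Tpar \<beta> N)"
  shows "\<exists>C. \<forall>\<^sub>F N in sequentially.
           \<forall>r \<in> {0..1}. \<forall>s \<in> {1, -1::real}.
             let z = complex_of_real r * exp (\<i> * complex_of_real (s * \<beta> * pi / 2)) in
             cmod (r_t \<beta> N z - csqrt z) \<le> C * exp (- sqrt (real N * hpar \<beta> / 4)) \<and>
             cmod (r_t \<beta> N z - csqrt z) \<le> C * exp (- pi * sqrt ((2 - \<beta>) * real N / 4))"
proof -
  obtain K where K: "\<forall>\<^sub>F N in sequentially.
      \<forall>r \<in> {exp (4 + 2*\<beta> - 2 * Tpar \<beta> N) .. 1}. \<forall>s \<in> {1, -1::real}.
        cmod (contour_integral (Gamma \<beta> N r)
          (\<lambda>u. fint \<beta> N u (complex_of_real r * exp (\<i> * complex_of_real (s * \<beta> * pi / 2))) * delta \<beta> u))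
        \<le> K * exp (- Tpar \<beta> N)"
    using assms(3) by blast
  define \<kappa> where "\<kappa> = cos (\<beta> * pi / 4)"
  have "\<beta> * pi < 2 * pi" using assms by (intro mult_strict_right_mono) auto
  then have \<kappa>: "\<kappa> > 0" unfolding \<kappa>_def using assms
    by (intro cos_gt_zero_pi) (auto intro: order_less_le_trans[of _ 0])
  \<comment> \<open>\<open>C1\<close> serves the range of the hypothesis; \<open>C2\<close> is the
    small-\<open>r\<close> constant with B = 2 + beta, where that range begins.\<close>
  define C1 C2 where "C1 = 8 + (1 + exp 1) / \<kappa>"
    and "C2 = exp (2 * (2 + \<beta>)) / \<kappa> + exp (2 + \<beta>)"
  have C: "C1 \<ge> 0" "C2 \<ge> 0" using \<kappa> by (auto simp: C1_def C2_def add_nonneg_nonneg)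
  \<comment> \<open>The absolute value keeps \<open>C\<close> above each single constant even if
    \<open>K\<close> is negative.\<close>
  define C where "C = \<bar>K\<bar> + C1 + C2"
  have exponent: "pi * sqrt ((2 - \<beta>) * real N / 4) = Tpar \<beta> N" for N
  proof -
    have "pi * sqrt x = sqrt (pi\<^sup>2 * x)" for x
      unfolding real_sqrt_mult by simp
    then show ?thesis by (simp add: Tpar_def hpar_def mult_ac)
  qed
  show ?thesis
  proof (rule exI[of _ C], rule eventually_mono[OF K], intro ballI)
    fix N r s
    assume bound: "\<forall>r \<in> {exp (4 + 2*\<beta> - 2 * Tpar \<beta> N) .. 1}. \<forall>s \<in> {1, -1::real}.
        cmod (contour_integral (Gamma \<beta> N r)
          (\<lambda>u. fint \<beta> N u (complex_of_real r * exp (\<i> * complex_of_real (s * \<beta> * pi / 2))) * delta \<beta> u))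
        \<le> K * exp (- Tpar \<beta> N)"
      and r: "r \<in> {0..1::real}" and s: "s \<in> {1, -1::real}"
    define \<theta> where "\<theta> = s * \<beta> * pi / 4"
    define \<zeta> where "\<zeta> = complex_of_real r * exp (\<i> * of_real (2 * \<theta>))"
    have \<zeta>_eq: "complex_of_real r * exp (\<i> * complex_of_real (s * \<beta> * pi / 2)) = \<zeta>"
    proof -
      have "s * \<beta> * pi / 2 = 2 * \<theta>" by (simp add: \<theta>_def)
      then show ?thesis by (simp only: \<zeta>_def)
    qed
    have abs: "\<bar>\<theta>\<bar> = \<beta> * pi / 4" using s assms by (auto simp: \<theta>_def)
    \<comment> \<open>Evenness of the cosine gives both rays the same constants.\<close>
    then have cos: "cos \<theta> = \<kappa>" by (metis \<kappa>_def cos_abs_real)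
    have "cmod (r_t \<beta> N \<zeta> - csqrt \<zeta>) \<le> C * exp (- Tpar \<beta> N)"
    proof (cases "r \<ge> exp (4 + 2*\<beta> - 2 * Tpar \<beta> N)")
      case True
      have r0: "0 < r" using True exp_gt_zero order_less_le_trans by blast
      then have "4 + 2*\<beta> - 2 * Tpar \<beta> N \<le> ln r" using True by (simp add: ln_ge_iff)
      then interpret Q: ray_quadrature \<beta> r \<theta> N
        using assms abs r r0 by unfold_locales auto
      have Qz: "Q.z = \<zeta>" by (simp only: Q.z_def \<zeta>_def)
      have "cmod (contour_integral (Gamma \<beta> N r) (\<lambda>u. fint \<beta> N u \<zeta> * delta \<beta> u)) \<le> K * exp (- Tpar \<beta> N)"
        using bspec[OF bspec[OF bound, of r] s] True r unfolding \<zeta>_eq by auto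
      also have "\<dots> \<le> \<bar>K\<bar> * exp (- Tpar \<beta> N)" by (intro mult_right_mono) auto
      finally have "cmod (r_t \<beta> N \<zeta> - csqrt \<zeta>) \<le> \<bar>K\<bar> * exp (- Tpar \<beta> N) + C1 * exp (- Tpar \<beta> N)"
        using Q.norm_r_t_minus_csqrt unfolding Qz cos C1_def by linarith
      also have "\<dots> \<le> C * exp (- Tpar \<beta> N)"
        using C by (simp add: C_def distrib_right)
      finally show ?thesis .
    next
      case False
      have "cmod (r_t \<beta> N \<zeta> - csqrt \<zeta>) \<le> C2 * exp (- Tpar \<beta> N)"
        unfolding \<zeta>_def C2_def cos[symmetric] using False r assms \<kappa> cos
        by (intro norm_r_t_minus_csqrt_small) (auto simp: algebra_simps)
      also have "\<dots> \<le> C * exp (- Tpar \<beta> N)"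
        using C by (intro mult_right_mono) (auto simp: C_def)
      finally show ?thesis .
    qed
    then show "let z = complex_of_real r * exp (\<i> * complex_of_real (s * \<beta> * pi / 2)) in
        cmod (r_t \<beta> N z - csqrt z) \<le> C * exp (- sqrt (real N * hpar \<beta> / 4)) \<and>
        cmod (r_t \<beta> N z - csqrt z) \<le> C * exp (- pi * sqrt ((2 - \<beta>) * real N / 4))"
      using exponent[of N] unfolding \<zeta>_eq Let_def Tpar_def by simp
  qed
qed

end
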